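(* If, for attacks $d',d''\in\{0,1\}^{\mathcal{N}}$, the set of distributed generators attacked in $d'$ is a subset of those attacked in $d''$, i.e. $\{i\in\mathcal{N}: d'_i=1\}\subseteq\{i\in\mathcal{N}: d''_i=1\}$, then the operator's loss due to $d'$ is not greater than that due to $d''$, i.e. $$\mathcal{C}_{\mathrm{Mm}}(d')\le\mathcal{C}_{\mathrm{Mm}}(d'').$$ Consequently, the resilience of the distribution network is monotonically non-increasing as the attack cardinality increases: if $\mathcal{R}_{\mathrm{Mm}}^{\mathrm{k}}$ denotes the resilience under attack cardinality $\mathrm{k}$, then $$\mathcal{R}_{\mathrm{Mm}}^{\mathrm{k}'}\ge\mathcal{R}_{\mathrm{Mm}}^{\mathrm{k}''}\qquad\forall\ 0\le\mathrm{k}'\le\mathrm{k}''\le\mathrm{N}.$$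
   Context: Network. The distribution network is a tree with node set $\mathcal{N}\cup\{0\}$, $\mathrm{N}=|\mathcal{N}|$, rooted at the substation node $0$, and edge set $\mathcal{E}$; $(i,j)\in\mathcal{E}$ means $i$ is the parent of $j$. Line $(i,j)$ has resistance $r_{ij}$ and reactance $x_{ij}$ with $0<r_{ij}\ll1$, $0<x_{ij}\ll1$. Each node $i\in\mathcal{N}$ has a load with nominal demand $\overline{pc}_i,\overline{qc}_i$ and minimum load control parameter $\underline\beta_i$, and a distributed generator (DG) with maximum active output $\overline{pg}_i$ and maximum ratio $\eta_i\ge0$ of absolute reactive to active output. Loads (resp. DGs) have lower and upper voltage bounds $\underline{\mathrm{vc}}_i,\overline{\mathrm{vc}}_i$ (resp. $\underline{\mathrm{vg}}_i,\overline{\mathrm{vg}}_i$) on squared voltage magnitude; lower bounds are positive. $\nu^{nom}$ is the nominal squared voltage and $\Delta\nu_0$ a given substation voltage drop. Attacker. $\mathcal{D}_{\mathrm{k}}=\{d\in\{0,1\}^{\mathcal{N}}:\sum_{i}d_i\le\mathrm{k}\}$; $d_i=1$ means the DG at $i$ is disrupted. Operator. A response is $u=(\beta,pg,qg,kc,kg)$, where $kc_i=1$ (resp. $kg_i=1$) means the load (resp. DG) at $i$ is disconnected. $\mathcal{U}$ is the set of $u$ such that for all $i\in\mathcal{N}$: $0\le pg_i\le\overline{pg}_i(1-kg_i)$, $-\eta_ipg_i\le qg_i\le\eta_ipg_i$, $kg_i,kc_i\in\{0,1\}$, $(1-kc_i)\underline\beta_i\le\beta_i\le 1-kc_i$. $\mathcal{U}(d)$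 is the set of $u\in\mathcal{U}$ with $kg_i\ge d_i$ and $pg_i\le\overline{pg}_i(1-d_i)$ for all $i$. Network states. $x=(pc,qc,p,q,P,Q,\nu,\ell)$. For $u\in\mathcal{U}$, $\mathcal{X}(u)$ is the set of $x$ with $\nu_0=\nu^{nom}-\Delta\nu_0$; for all $i\in\mathcal{N}$: $pc_i=\beta_i\overline{pc}_i$, $qc_i=\beta_i\overline{qc}_i$, $kg_i\ge\underline{\mathrm{vg}}_i-\nu_i$, $kg_i\ge\nu_i-\overline{\mathrm{vg}}_i$, $kc_i\ge\underline{\mathrm{vc}}_i-\nu_i$, $kc_i\ge\nu_i-\overline{\mathrm{vc}}_i$, $p_i=pc_i-pg_i$, $q_i=qc_i-qg_i$; and for all $(i,j)\in\mathcal{E}$: $P_{ij}=\sum_{k:(j,k)\in\mathcal{E}}P_{jk}+p_j+r_{ij}\ell_{ij}$, $Q_{ij}=\sum_{k:(j,k)\in\mathcal{E}}Q_{jk}+q_j+x_{ij}\ell_{ij}$, $\nu_j=\nu_i-2r_{ij}P_{ij}-2x_{ij}Q_{ij}+(r_{ij}^2+x_{ij}^2)\ell_{ij}$, $\ell_{ij}\nu_i\ge P_{ij}^2+Q_{ij}^2$. Loss. With $W^{VR},W^{LL},W^{LC}_i,W^{LS}_i\in\mathbb{R}_+$ and $W^{LS}_i\ge W^{LC}_i$, $$L(u,x)=W^{VR}\max_{i\in\mathcal{N}}|\nu^{nom}-\nu_i|+\sum_{i\in\mathcal{N}}W^{LC}_i(1-\beta_i)\overline{pc}_i+\sum_{i\in\mathcal{N}}(W^{LS}_i-W^{LC}_i)kc_i\overline{pc}_i+W^{LL}\sum_{(i,j)\in\mathcal{E}}r_{ij}\ell_{ij}.$$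 Define $\mathcal{C}_{\mathrm{Mm}}(d)=\min_{u\in\mathcal{U}(d),\,x\in\mathcal{X}(u)}L(u,x)$ for $d\in\{0,1\}^{\mathcal{N}}$ and, with $\mathcal{L}_{\max}$ the loss incurred when all loads and DGs are disconnected, $$\mathcal{R}_{\mathrm{Mm}}^{\mathrm{k}}=100\Bigl(1-\frac{\max_{d\in\mathcal{D}_{\mathrm{k}}}\mathcal{C}_{\mathrm{Mm}}(d)}{\mathcal{L}_{\max}}\Bigr).$$ Standing assumption (No Reverse Power Flow, NRPF): with $\mathcal{N}_i$ the node set of the subtree rooted at $i$ (including $i$), $\sum_{j\in\mathcal{N}_i}p_j\ge0$ and $\sum_{j\in\mathcal{N}_i}q_j\ge0$ for all $i\in\mathcal{N}$; this is assumed to hold even when all DGs produce maximum output, i.e. $pg_i=\overline{pg}_i$ and $qg_i=\eta_i\overline{pg}_i$ for all $i\in\mathcal{N}$. *)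

theory Defs
  imports Complex_Main "HOL-Library.Extended_Real" "HOL-Library.FuncSet"
begin

text \<open>The substation \<open>root\<close> is not a member of \<open>nodes\<close>; an edge \<open>(i, j)\<close> means that
  \<open>i\<close> is the parent of \<open>j\<close>. Voltages are squared magnitudes throughout.\<close>

record 'v network =
  nodes :: "'v set"
  root :: 'v
  edges :: "('v \<times> 'v) set"
  res :: "'v \<times> 'v \<Rightarrow> real"
  rea :: "'v \<times> 'v \<Rightarrow> real"
  pc_nom :: "'v \<Rightarrow> real"
  qc_nom :: "'v \<Rightarrow> real"
  beta_min :: "'v \<Rightarrow> real"
  pg_max :: "'v \<Rightarrow> real"
  eta :: "'v \<Rightarrow> real"
  vc_lo :: "'v \<Rightarrow> real"
  vc_up :: "'v \<Rightarrow> real"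
  vg_lo :: "'v \<Rightarrow> real"
  vg_up :: "'v \<Rightarrow> real"
  nu_nom :: real
  dnu0 :: real
  W_VR :: real
  W_LL :: real
  W_LC :: "'v \<Rightarrow> real"
  W_LS :: "'v \<Rightarrow> real"

text \<open>Trees are given as arborescences: every node other than the root has exactly one parent and
  is reachable from the root, which has no parent.\<close>

definition rooted_tree :: "'v set \<Rightarrow> 'v \<Rightarrow> ('v \<times> 'v) set \<Rightarrow> bool" where
  "rooted_tree N r E \<longleftrightarrow>
     finite N \<and> r \<notin> N \<and> E \<subseteq> insert r N \<times> N \<and>
     (\<forall>j\<in>N. \<exists>!i. (i, j) \<in> E) \<and> (\<forall>j\<in>N. (r, j) \<in> E\<^sup>*)"

text \<open>The smallness of the line parameters (far below 1) is rendered by its rigorous consequence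
  that they are below 1.\<close>

definition distribution_network :: "'v network \<Rightarrow> bool" where
  "distribution_network D \<longleftrightarrow>
     rooted_tree (nodes D) (root D) (edges D) \<and> nodes D \<noteq> {} \<and>
     (\<forall>e\<in>edges D. 0 < res D e \<and> res D e < 1 \<and> 0 < rea D e \<and> rea D e < 1) \<and>
     (\<forall>i\<in>nodes D. 0 \<le> pc_nom D i \<and> 0 \<le> pg_max D i \<and> 0 \<le> eta D i \<and>
        0 < vc_lo D i \<and> 0 < vg_lo D i) \<and>
     0 \<le> W_VR D \<and> 0 \<le> W_LL D \<and>
     (\<forall>i\<in>nodes D. 0 \<le> W_LC D i \<and> W_LC D i \<le> W_LS D i)"

definition subtree_nodes :: "'v network \<Rightarrow> 'v \<Rightarrow> 'v set" where
  "subtree_nodes D i = {j \<in> nodes D. (i, j) \<in> (edges D)\<^sup>*}"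

definition nrpf_for :: "'v network \<Rightarrow> ('v \<Rightarrow> real) \<Rightarrow> ('v \<Rightarrow> real) \<Rightarrow> bool" where
  "nrpf_for D p q \<longleftrightarrow>
     (\<forall>i\<in>nodes D. 0 \<le> (\<Sum>j\<in>subtree_nodes D i. p j) \<and> 0 \<le> (\<Sum>j\<in>subtree_nodes D i. q j))"

text \<open>No reverse power flow, with nominal demand and all DGs at maximum output; since outputs
  satisfy \<open>pg \<le> pg_max\<close> and \<open>qg \<le> eta * pg_max\<close>, it then holds for all smaller outputs as well.\<close>

definition no_reverse_power_flow :: "'v network \<Rightarrow> bool" where
  "no_reverse_power_flow D \<longleftrightarrow>
     nrpf_for D (\<lambda>j. pc_nom D j - pg_max D j) (\<lambda>j. qc_nom D j - eta D j * pg_max D j)"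

definition nu_sub :: "'v network \<Rightarrow> real" where
  "nu_sub D = nu_nom D - dnu0 D"

text \<open>Attack vectors are extensional functions on the node set, so that there are finitely many.\<close>

definition attacks :: "'v network \<Rightarrow> ('v \<Rightarrow> real) set" where
  "attacks D = nodes D \<rightarrow>\<^sub>E {0, 1}"

definition attacks_upto :: "'v network \<Rightarrow> nat \<Rightarrow> ('v \<Rightarrow> real) set" where
  "attacks_upto D k = {d \<in> attacks D. (\<Sum>i\<in>nodes D. d i) \<le> real k}"

record 'v response =
  beta :: "'v \<Rightarrow> real"
  pg :: "'v \<Rightarrow> real"
  qg :: "'v \<Rightarrow> real"
  kc :: "'v \<Rightarrow> real"
  kg :: "'v \<Rightarrow> real"

record 'v state =
  st_pc :: "'v \<Rightarrow> real"
  st_qc :: "'v \<Rightarrow> real"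
  st_p :: "'v \<Rightarrow> real"
  st_q :: "'v \<Rightarrow> real"
  st_P :: "'v \<times> 'v \<Rightarrow> real"
  st_Q :: "'v \<times> 'v \<Rightarrow> real"
  st_nu :: "'v \<Rightarrow> real"
  st_l :: "'v \<times> 'v \<Rightarrow> real"

definition responses :: "'v network \<Rightarrow> 'v response set" where
  "responses D = {u. \<forall>i\<in>nodes D.
     0 \<le> pg u i \<and> pg u i \<le> pg_max D i * (1 - kg u i) \<and>
     - (eta D i * pg u i) \<le> qg u i \<and> qg u i \<le> eta D i * pg u i \<and>
     kg u i \<in> {0, 1} \<and> kc u i \<in> {0, 1} \<and>
     (1 - kc u i) * beta_min D i \<le> beta u i \<and> beta u i \<le> 1 - kc u i}"

definition responses_to :: "'v network \<Rightarrow> ('v \<Rightarrow> real) \<Rightarrow> 'v response set" where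
  "responses_to D d = {u \<in> responses D. \<forall>i\<in>nodes D.
     d i \<le> kg u i \<and> pg u i \<le> pg_max D i * (1 - d i)}"

definition states :: "'v network \<Rightarrow> 'v response \<Rightarrow> 'v state set" where
  "states D u = {x.
     st_nu x (root D) = nu_sub D \<and>
     (\<forall>i\<in>nodes D.
        st_pc x i = beta u i * pc_nom D i \<and>
        st_qc x i = beta u i * qc_nom D i \<and>
        vg_lo D i - st_nu x i \<le> kg u i \<and> st_nu x i - vg_up D i \<le> kg u i \<and>
        vc_lo D i - st_nu x i \<le> kc u i \<and> st_nu x i - vc_up D i \<le> kc u i \<and>
        st_p x i = st_pc x i - pg u i \<and>
        st_q x i = st_qc x i - qg u i) \<and>
     (\<forall>(i, j)\<in>edges D.
        st_P x (i, j) = (\<Sum>k | (j, k) \<in> edges D. st_P x (j, k)) + st_p x j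
                          + res D (i, j) * st_l x (i, j) \<and>
        st_Q x (i, j) = (\<Sum>k | (j, k) \<in> edges D. st_Q x (j, k)) + st_q x j
                          + rea D (i, j) * st_l x (i, j) \<and>
        st_nu x j = st_nu x i - 2 * res D (i, j) * st_P x (i, j) - 2 * rea D (i, j) * st_Q x (i, j)
                      + ((res D (i, j))\<^sup>2 + (rea D (i, j))\<^sup>2) * st_l x (i, j) \<and>
        st_l x (i, j) * st_nu x i \<ge> (st_P x (i, j))\<^sup>2 + (st_Q x (i, j))\<^sup>2)}"

definition loss :: "'v network \<Rightarrow> 'v response \<Rightarrow> 'v state \<Rightarrow> real" where
  "loss D u x =
     W_VR D * (MAX i\<in>nodes D. \<bar>nu_nom D - st_nu x i\<bar>)
     + (\<Sum>i\<in>nodes D. W_LC D i * (1 - beta u i) * pc_nom D i)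
     + (\<Sum>i\<in>nodes D. (W_LS D i - W_LC D i) * kc u i * pc_nom D i)
     + W_LL D * (\<Sum>e\<in>edges D. res D e * st_l x e)"

text \<open>On the coordinates indexed by the network the feasible set is compact: the disconnection
  constraints bound the voltages, and for a fixed response these determine the currents and flows.
  So the infimum is a minimum whenever the problem is feasible; an infeasible problem has
  value \<open>\<infinity>\<close>.\<close>

definition C_Mm :: "'v network \<Rightarrow> ('v \<Rightarrow> real) \<Rightarrow> ereal" where
  "C_Mm D d = (INF (u, x) \<in> (SIGMA u : responses_to D d. states D u). ereal (loss D u x))"

text \<open>With every load and DG disconnected no current flows and all nodes are at the substation
  voltage.\<close>

definition all_disconnected :: "'v response" where
  "all_disconnected = \<lparr>beta = \<lambda>_. 0, pg = \<lambda>_. 0, qg = \<lambda>_. 0, kc = \<lambda>_. 1, kg = \<lambda>_. 1\<rparr>"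

definition idle_state :: "'v network \<Rightarrow> 'v state" where
  "idle_state D = \<lparr>st_pc = \<lambda>_. 0, st_qc = \<lambda>_. 0, st_p = \<lambda>_. 0, st_q = \<lambda>_. 0,
     st_P = \<lambda>_. 0, st_Q = \<lambda>_. 0, st_nu = \<lambda>_. nu_sub D, st_l = \<lambda>_. 0\<rparr>"

lemma all_disconnected_mem: "all_disconnected \<in> responses D"
  by (simp add: responses_def all_disconnected_def)

lemma idle_state_mem:
  assumes "\<And>i. i \<in> nodes D \<Longrightarrow> vg_lo D i - 1 \<le> nu_sub D \<and> nu_sub D \<le> vg_up D i + 1"
    and "\<And>i. i \<in> nodes D \<Longrightarrow> vc_lo D i - 1 \<le> nu_sub D \<and> nu_sub D \<le> vc_up D i + 1"
  shows "idle_state D \<in> states D all_disconnected"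
  using assms by (force simp: states_def idle_state_def all_disconnected_def)

definition L_max :: "'v network \<Rightarrow> real" where
  "L_max D = loss D all_disconnected (idle_state D)"

definition R_Mm :: "'v network \<Rightarrow> nat \<Rightarrow> ereal" where
  "R_Mm D k = 100 * (1 - (MAX d\<in>attacks_upto D k. C_Mm D d) / ereal (L_max D))"

end

theory Submission
  imports Defs
begin

text \<open>Disrupting more DGs only shrinks the operator's feasible set, so the minimum loss can only
  grow; raising the budget \<open>k\<close> only enlarges the attacker's feasible set, so the worst-case loss can
  only grow. The resilience is an antitone function of the latter because \<open>L_max\<close> is nonnegative.\<close>

text \<open>The bound on \<open>kg\<close> tightens as \<open>d\<close> grows, and so does the cap
  \<open>pg_max D i * (1 - d i)\<close>, the latter because \<open>pg_max\<close> is
  nonnegative.\<close>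

lemma responses_to_antimono:
  assumes "\<And>i. i \<in> nodes D \<Longrightarrow> 0 \<le> pg_max D i"
    and "\<And>i. i \<in> nodes D \<Longrightarrow> d' i \<le> d'' i"
  shows "responses_to D d'' \<subseteq> responses_to D d'"
proof
  fix u assume u: "u \<in> responses_to D d''"
  have "d' i \<le> kg u i \<and> pg u i \<le> pg_max D i * (1 - d' i)" if i: "i \<in> nodes D" for i
  proof -
    have "pg_max D i * (1 - d'' i) \<le> pg_max D i * (1 - d' i)"
      using assms i by (intro mult_left_mono) auto
    then show ?thesis
      using u assms(2) i unfolding responses_to_def by force
  qed
  then show "u \<in> responses_to D d'"
    using u by (simp add: responses_to_def)
qed

text \<open>The attack enters only through the index set of the infimum. Comparing infima requires
  neither attainment nor feasibility: an empty index set yields the value infinity.\<close>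

lemma C_Mm_mono:
  assumes "\<And>i. i \<in> nodes D \<Longrightarrow> 0 \<le> pg_max D i"
    and "\<And>i. i \<in> nodes D \<Longrightarrow> d' i \<le> d'' i"
  shows "C_Mm D d' \<le> C_Mm D d''"
  unfolding C_Mm_def
  using responses_to_antimono[OF assms] by (intro INF_superset_mono Sigma_mono) auto

lemma attacks_le_iff:
  assumes "d' \<in> attacks D" and "d'' \<in> attacks D"
  shows "(\<forall>i\<in>nodes D. d' i \<le> d'' i)
    \<longleftrightarrow> {i \<in> nodes D. d' i = 1} \<subseteq> {i \<in> nodes D. d'' i = 1}"
proof -
  have "d' i \<in> {0, 1} \<and> d'' i \<in> {0, 1}" if "i \<in> nodes D" for i
    using assms that by (auto simp: attacks_def)
  then show ?thesis by force
qed

lemma finite_attacks_upto: "finite (nodes D) \<Longrightarrow> finite (attacks_upto D k)"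
  by (simp add: attacks_upto_def attacks_def finite_PiE)

text \<open>Needed for \<open>Max_mono\<close>, as \<open>Max\<close> is unspecified on the empty
  set. The null attack fits every budget; \<open>restrict\<close> makes it extensional.\<close>

lemma attacks_upto_nonempty: "attacks_upto D k \<noteq> {}"
proof -
  have "restrict (\<lambda>_. 0) (nodes D) \<in> attacks_upto D k"
    by (auto simp: attacks_upto_def attacks_def)
  then show ?thesis by blast
qed

lemma attacks_upto_mono: "k' \<le> k'' \<Longrightarrow> attacks_upto D k' \<subseteq> attacks_upto D k''"
  by (force simp: attacks_upto_def)

lemma L_max_nonneg:
  assumes "distribution_network D"
  shows "0 \<le> L_max D"
proof -
  have "nodes D \<noteq> {}"
    using assms by (simp add: distribution_network_def)
  \<comment> \<open>All idle voltages coincide, so the maximum is over a singleton and visibly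
    nonnegative.\<close>
  then have "(\<lambda>i. \<bar>nu_nom D - nu_sub D\<bar>) ` nodes D = {\<bar>nu_nom D - nu_sub D\<bar>}"
    by auto
  then show ?thesis
    using assms
    by (auto simp: L_max_def loss_def all_disconnected_def idle_state_def distribution_network_def
        intro!: add_nonneg_nonneg mult_nonneg_nonneg sum_nonneg)
qed

lemma R_Mm_antimono:
  assumes D: "distribution_network D" and "k' \<le> k''"
  shows "R_Mm D k'' \<le> R_Mm D k'"
proof -
  have fin: "finite (nodes D)"
    using D by (simp add: distribution_network_def rooted_tree_def)
  have "(MAX d\<in>attacks_upto D k'. C_Mm D d) \<le> (MAX d\<in>attacks_upto D k''. C_Mm D d)"
    using attacks_upto_mono[OF \<open>k' \<le> k''\<close>] finite_attacks_upto[OF fin] attacks_upto_nonempty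
    by (intro Max_mono image_mono) simp_all
  \<comment> \<open>If \<open>L_max D = 0\<close>, this is multiplication by \<open>inverse 0 = \<infinity>\<close>, which is still monotone.\<close>
  moreover have "0 \<le> inverse (ereal (L_max D))"
    using L_max_nonneg[OF D] by (simp add: ereal_inverse_nonneg_iff)
  ultimately have "(MAX d\<in>attacks_upto D k'. C_Mm D d) / ereal (L_max D)
      \<le> (MAX d\<in>attacks_upto D k''. C_Mm D d) / ereal (L_max D)"
    unfolding divide_ereal_def by (rule ereal_mult_right_mono)
  \<comment> \<open>Subtraction from 1 is antitone on all of \<open>ereal\<close>, so infinite
    worst-case losses need no separate case.\<close>
  then show ?thesis
    unfolding R_Mm_def by (intro ereal_mult_left_mono ereal_minus_mono) auto
qed

theorem proposition5:
  fixes D :: "'v network"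
  assumes "distribution_network D"
    and "no_reverse_power_flow D"
  shows "(\<forall>d'\<in>attacks D. \<forall>d''\<in>attacks D.
            {i \<in> nodes D. d' i = 1} \<subseteq> {i \<in> nodes D. d'' i = 1} \<longrightarrow> C_Mm D d' \<le> C_Mm D d'')
       \<and> (\<forall>k' k''. k' \<le> k'' \<and> k'' \<le> card (nodes D) \<longrightarrow> R_Mm D k' \<ge> R_Mm D k'')"
proof (intro conjI ballI allI impI)
  fix d' d''
  assume "d' \<in> attacks D" "d'' \<in> attacks D"
    and "{i \<in> nodes D. d' i = 1} \<subseteq> {i \<in> nodes D. d'' i = 1}"
  then have "\<And>i. i \<in> nodes D \<Longrightarrow> d' i \<le> d'' i"
    using attacks_le_iff by blast
  then show "C_Mm D d' \<le> C_Mm D d''"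
    using assms(1) by (intro C_Mm_mono) (auto simp: distribution_network_def)
next
  fix k' k'' :: nat
  assume "k' \<le> k'' \<and> k'' \<le> card (nodes D)"
  then show "R_Mm D k'' \<le> R_Mm D k'"
    using R_Mm_antimono[OF assms(1)] by blast
qed

end
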